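(* Let $\beta$ be any additive function (with values in an abelian group) on the constructible subsets of $F$. Then $$\beta(F)=\sum_{d\in\mathcal P}\beta(F(d)^\circ).$$
   Context: $V=\mathbb C^\ell$ and $G\subset GL(V)$ is an irreducible finite complex (unitary) reflection group with invariant degrees $d_1,\dots,d_\ell$. $\mathcal A$ is the set of reflecting hyperplanes of $G$; for $H\in\mathcal A$, $e_H$ is the order of the pointwise stabiliser of $H$ in $G$ and $\ell_H\in V^*$ is a linear form with kernel $H$. $Q=\prod_{H\in\mathcal A}\ell_H^{e_H}$ and $F=\{v\in V: Q(v)=1\}$. $\zeta_d=\exp(2\pi i/d)$; $V(g,\zeta)$ is the $\zeta$-eigenspace of $g\in G$. A vector is regular if it lies on no reflecting hyperplane; $d$ is a regular number if some $V(g,\zeta_d)$, $g\in G$, contains a regular vector. For a regular number $d$, $\bar d:=\gcd\{d_i: d\mid d_i\}$. $\mathcal P$ is the set of regular numbers $d$ with $d=\bar d$. For $d\in\mathcal P$, $V(d)=\bigcup_{g\in G}V(g,\zeta_d)$, $F(d)=V(d)\cap F$, and $F(d)^\circ=F(d)\setminus\bigcup_{e\in\mathcal P,\ d\mid e,\ e\ne d}F(e)$. A function $\beta:\mathcal B\to A$ from the Boolean algebra $\mathcal B$ of constructible subsets of $F$ to an abelian group $A$ is additive if $\beta(Y)=\beta(Z)+\beta(Y\setminus Z)$ whenever $Y\supseteq Z$ in $\mathcal B$. *)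

theory Defs
  imports "HOL-Analysis.Analysis" "HOL-Algebra.Generated_Groups"
begin

section \<open>Finite irreducible complex reflection groups\<close>

definition GL :: "(complex^'n^'n) monoid" where
  "GL = \<lparr>carrier = {g. invertible g}, mult = (**), one = mat 1\<rparr>"

definition fixed_space :: "complex^'n^'n \<Rightarrow> (complex^'n) set" where
  "fixed_space g = {v. g *v v = v}"

text \<open>For an element of a finite group, finite order need not be demanded separately. The
  constant \<open>vec.dim\<close> is the dimension over the complex numbers, and \<open>CARD('n) \<ge> 1\<close>, so
  a reflection is never the identity.\<close>

definition reflections :: "(complex^'n^'n) set \<Rightarrow> (complex^'n^'n) set" where
  "reflections G = {g \<in> G. vec.dim (fixed_space g) = CARD('n) - 1}"

definition reflecting_hyperplanes :: "(complex^'n^'n) set \<Rightarrow> (complex^'n) set set" where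
  "reflecting_hyperplanes G = fixed_space ` reflections G"

definition irreducible_on :: "(complex^'n^'n) set \<Rightarrow> bool" where
  "irreducible_on G \<longleftrightarrow>
     (\<forall>W. vec.subspace W \<and> (\<forall>g\<in>G. \<forall>w\<in>W. g *v w \<in> W) \<longrightarrow> W = {0} \<or> W = UNIV)"

definition irreducible_reflection_group :: "(complex^'n^'n) set \<Rightarrow> bool" where
  "irreducible_reflection_group G \<longleftrightarrow>
     subgroup G GL \<and> finite G \<and> generate GL (reflections G) = G \<and> irreducible_on G"

section \<open>Polynomial functions and invariant degrees\<close>

text \<open>The field being infinite, the coordinate ring of \<open>V\<close> is identified with the ring of
  polynomial functions on \<open>V\<close>.\<close>

inductive polynomial_fun :: "(complex^'n \<Rightarrow> complex) \<Rightarrow> bool" where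
  const: "polynomial_fun (\<lambda>v. c)"
| coord: "polynomial_fun (\<lambda>v. v $ i)"
| add: "polynomial_fun p \<Longrightarrow> polynomial_fun q \<Longrightarrow> polynomial_fun (\<lambda>v. p v + q v)"
| mult: "polynomial_fun p \<Longrightarrow> polynomial_fun q \<Longrightarrow> polynomial_fun (\<lambda>v. p v * q v)"

text \<open>Linear combinations of monomials of degree \<open>k\<close>; a monomial is given by its exponent
  vector \<open>m\<close>.\<close>

definition homogeneous_fun :: "nat \<Rightarrow> (complex^'n \<Rightarrow> complex) \<Rightarrow> bool" where
  "homogeneous_fun k p \<longleftrightarrow>
     (\<exists>(M :: ('n \<Rightarrow> nat) set) a. finite M \<and> (\<forall>m\<in>M. (\<Sum>i\<in>UNIV. m i) = k) \<and>
        p = (\<lambda>v. \<Sum>m\<in>M. a m * (\<Prod>i\<in>UNIV. (v $ i) ^ m i)))"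

definition invariant_fun :: "(complex^'n^'n) set \<Rightarrow> (complex^'n \<Rightarrow> complex) \<Rightarrow> bool" where
  "invariant_fun G p \<longleftrightarrow> polynomial_fun p \<and> (\<forall>g\<in>G. \<forall>v. p (g *v v) = p v)"

definition algebraically_independent :: "('n \<Rightarrow> complex^'n \<Rightarrow> complex) \<Rightarrow> bool" where
  "algebraically_independent f \<longleftrightarrow>
     (\<forall>p. polynomial_fun p \<and> (\<forall>v. p (\<chi> i. f i v) = 0) \<longrightarrow> p = (\<lambda>x. 0))"

definition basic_invariants ::
    "(complex^'n^'n) set \<Rightarrow> ('n \<Rightarrow> nat) \<Rightarrow> ('n \<Rightarrow> complex^'n \<Rightarrow> complex) \<Rightarrow> bool" where
  "basic_invariants G deg f \<longleftrightarrow>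
     (\<forall>i. invariant_fun G (f i) \<and> homogeneous_fun (deg i) (f i)) \<and>
     algebraically_independent f \<and>
     (\<forall>q. invariant_fun G q \<longrightarrow> (\<exists>p. polynomial_fun p \<and> q = (\<lambda>v. p (\<chi> i. f i v))))"

text \<open>By the theorem of Shephard, Todd and Chevalley every finite reflection group has such a family,
  and it is unique up to reindexing.\<close>

definition invariant_degrees :: "(complex^'n^'n) set \<Rightarrow> ('n \<Rightarrow> nat) \<Rightarrow> bool" where
  "invariant_degrees G deg \<longleftrightarrow> (\<exists>f. basic_invariants G deg f)"

section \<open>The hypersurface\<close>

definition stabiliser_order :: "(complex^'n^'n) set \<Rightarrow> (complex^'n) set \<Rightarrow> nat" where
  "stabiliser_order G H = card {g \<in> G. \<forall>v\<in>H. g *v v = v}"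

definition defining_forms ::
    "(complex^'n^'n) set \<Rightarrow> ((complex^'n) set \<Rightarrow> complex^'n \<Rightarrow> complex) \<Rightarrow> bool" where
  "defining_forms G lf \<longleftrightarrow>
     (\<forall>H\<in>reflecting_hyperplanes G.
        Vector_Spaces.linear (*s) (*) (lf H) \<and> {v. lf H v = 0} = H)"

definition discriminant ::
    "(complex^'n^'n) set \<Rightarrow> ((complex^'n) set \<Rightarrow> complex^'n \<Rightarrow> complex) \<Rightarrow> complex^'n \<Rightarrow> complex"
  where
  "discriminant G lf v = (\<Prod>H\<in>reflecting_hyperplanes G. lf H v ^ stabiliser_order G H)"

definition milnor_fibre ::
    "(complex^'n^'n) set \<Rightarrow> ((complex^'n) set \<Rightarrow> complex^'n \<Rightarrow> complex) \<Rightarrow> (complex^'n) set" where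
  "milnor_fibre G lf = {v. discriminant G lf v = 1}"

section \<open>Regular numbers and the strata\<close>

definition root_unity :: "nat \<Rightarrow> complex" where
  "root_unity d = exp (2 * of_real pi * \<i> / of_nat d)"

definition eigenspace :: "complex^'n^'n \<Rightarrow> complex \<Rightarrow> (complex^'n) set" where
  "eigenspace g z = {v. g *v v = z *s v}"

definition regular_vector :: "(complex^'n^'n) set \<Rightarrow> complex^'n \<Rightarrow> bool" where
  "regular_vector G v \<longleftrightarrow> (\<forall>H\<in>reflecting_hyperplanes G. v \<notin> H)"

definition regular_number :: "(complex^'n^'n) set \<Rightarrow> nat \<Rightarrow> bool" where
  "regular_number G d \<longleftrightarrow>
     d \<ge> 1 \<and> (\<exists>g\<in>G. \<exists>v\<in>eigenspace g (root_unity d). regular_vector G v)"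

definition dbar :: "('n \<Rightarrow> nat) \<Rightarrow> nat \<Rightarrow> nat" where
  "dbar deg d = Gcd {deg i | i. d dvd deg i}"

definition PP :: "(complex^'n^'n) set \<Rightarrow> ('n \<Rightarrow> nat) \<Rightarrow> nat set" where
  "PP G deg = {d. regular_number G d \<and> d = dbar deg d}"

definition eigen_union :: "(complex^'n^'n) set \<Rightarrow> nat \<Rightarrow> (complex^'n) set" where
  "eigen_union G d = (\<Union>g\<in>G. eigenspace g (root_unity d))"

definition fibre_part ::
    "(complex^'n^'n) set \<Rightarrow> ((complex^'n) set \<Rightarrow> complex^'n \<Rightarrow> complex) \<Rightarrow> nat \<Rightarrow> (complex^'n) set"
  where
  "fibre_part G lf d = eigen_union G d \<inter> milnor_fibre G lf"

definition fibre_stratum ::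
    "(complex^'n^'n) set \<Rightarrow> ('n \<Rightarrow> nat) \<Rightarrow> ((complex^'n) set \<Rightarrow> complex^'n \<Rightarrow> complex) \<Rightarrow> nat
      \<Rightarrow> (complex^'n) set" where
  "fibre_stratum G deg lf d =
     fibre_part G lf d - (\<Union>e\<in>{e \<in> PP G deg. d dvd e \<and> e \<noteq> d}. fibre_part G lf e)"

text \<open>The index set of the sum in the theorem is finite, so that sum is a genuine one.\<close>

lemma invariant_degrees_pos:
  assumes "invariant_degrees G deg"
  shows "deg i > 0"
proof (rule ccontr)
  assume "\<not> deg i > 0"
  hence d0: "deg i = 0" by simp
  obtain f where f: "basic_invariants G deg f"
    using assms unfolding invariant_degrees_def by blast
  hence "homogeneous_fun 0 (f i)" using d0 unfolding basic_invariants_def by metis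
  then obtain M a where M: "finite M" "\<forall>m\<in>M. (\<Sum>j\<in>UNIV. m j) = 0"
      "f i = (\<lambda>v. \<Sum>m\<in>M. a m * (\<Prod>j\<in>UNIV. (v $ j) ^ m j))"
    unfolding homogeneous_fun_def by blast
  have "f i = (\<lambda>v. \<Sum>m\<in>M. a m)"
    unfolding M(3) using M(2) by (intro ext sum.cong) auto
  then obtain c where c: "f i = (\<lambda>v. c)" by blast
  define p where "p = (\<lambda>v :: complex^'a. v $ i + (- c))"
  have "polynomial_fun p" unfolding p_def by (intro polynomial_fun.intros)
  moreover have "\<forall>v. p (\<chi> j. f j v) = 0" by (simp add: p_def c)
  ultimately have "p = (\<lambda>v. 0)"
    using f unfolding basic_invariants_def algebraically_independent_def by blast
  hence "p (\<chi> j. c + 1) = 0" by simp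
  thus False by (simp add: p_def)
qed

lemma finite_PP:
  assumes "invariant_degrees G deg"
  shows "finite (PP G deg)"
proof (rule finite_subset)
  show "PP G deg \<subseteq> (\<Union>i. {..deg i})"
  proof
    fix d assume "d \<in> PP G deg"
    hence d: "d \<ge> 1" "d = Gcd {deg i | i. d dvd deg i}"
      unfolding PP_def regular_number_def dbar_def by auto
    have "{deg i | i. d dvd deg i} \<noteq> {}"
      using d by (metis Gcd_empty not_one_le_zero)
    then obtain i where "d dvd deg i" by blast
    hence "d \<le> deg i" using invariant_degrees_pos[OF assms] by (simp add: dvd_imp_le)
    thus "d \<in> (\<Union>i. {..deg i})" by auto
  qed
qed simp

section \<open>Constructible sets and additive functions\<close>

definition zariski_closed :: "(complex^'n) set \<Rightarrow> bool" where
  "zariski_closed Z \<longleftrightarrow>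
     (\<exists>S. (\<forall>p\<in>S. polynomial_fun p) \<and> Z = {v. \<forall>p\<in>S. p v = 0})"

text \<open>The Boolean algebra of subsets of \<open>F\<close> generated by the relatively Zariski closed ones.\<close>

inductive_set constructible :: "(complex^'n) set \<Rightarrow> (complex^'n) set set"
  for F :: "(complex^'n) set" where
  closed: "zariski_closed Z \<Longrightarrow> F \<inter> Z \<in> constructible F"
| compl: "Y \<in> constructible F \<Longrightarrow> F - Y \<in> constructible F"
| union: "Y \<in> constructible F \<Longrightarrow> Z \<in> constructible F \<Longrightarrow> Y \<union> Z \<in> constructible F"

text \<open>Only the values of \<open>\<beta>\<close> on members of \<open>B\<close> are constrained.\<close>

definition additive_on :: "'b set set \<Rightarrow> ('b set \<Rightarrow> 'a::ab_group_add) \<Rightarrow> bool" where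
  "additive_on B \<beta> \<longleftrightarrow> (\<forall>Y\<in>B. \<forall>Z\<in>B. Z \<subseteq> Y \<longrightarrow> \<beta> Y = \<beta> Z + \<beta> (Y - Z))"

end

theory Submission
  imports Defs
begin

text \<open>
  The strata partition \<open>F\<close>, and additivity does the rest. Invariant polynomials separate the
  orbits of the finite group \<open>G\<close>, so by homogeneity \<open>v \<in> V(d)\<close> if and only if \<open>d\<close> divides every
  \<open>d\<^sub>i\<close> with \<open>f\<^sub>i(v) \<noteq> 0\<close> (Springer). For \<open>v \<noteq> 0\<close> the number
  \<open>D = gcd {d\<^sub>i : f\<^sub>i(v) \<noteq> 0}\<close> is therefore the largest \<open>d\<close>, for divisibility, with
  \<open>v \<in> V(d)\<close>; if \<open>v\<close> is regular then \<open>D\<close> lies in \<open>\<P>\<close>, because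
  \<open>{d\<^sub>i : f\<^sub>i(v) \<noteq> 0} \<subseteq> {d\<^sub>i : D | d\<^sub>i}\<close>, and the stratum of \<open>D\<close> is the only one containing \<open>v\<close>.
\<close>

section \<open>Polynomial functions\<close>

lemma polynomial_fun_sum:
  assumes "\<And>i. i \<in> I \<Longrightarrow> polynomial_fun (p i)"
  shows "polynomial_fun (\<lambda>v. \<Sum>i\<in>I. p i v)"
  using assms
  by (induction I rule: infinite_finite_induct) (auto intro: polynomial_fun.intros)

lemma polynomial_fun_prod:
  assumes "\<And>i. i \<in> I \<Longrightarrow> polynomial_fun (p i)"
  shows "polynomial_fun (\<lambda>v. \<Prod>i\<in>I. p i v)"
  using assms
  by (induction I rule: infinite_finite_induct) (auto intro: polynomial_fun.intros)

lemma polynomial_fun_diff: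
  assumes "polynomial_fun p" "polynomial_fun q"
  shows "polynomial_fun (\<lambda>v. p v - q v)"
  using polynomial_fun.add[OF assms(1) polynomial_fun.mult[OF polynomial_fun.const[of "-1"] assms(2)]]
  by simp

lemma polynomial_fun_matrix_component: "polynomial_fun (\<lambda>v. (g *v v) $ i)"
  unfolding matrix_vector_mult_def
  by (simp, intro polynomial_fun_sum polynomial_fun.intros)

lemma polynomial_fun_comp_matrix:
  assumes "polynomial_fun p"
  shows "polynomial_fun (\<lambda>v. p (g *v v))"
  using assms
  by induction (auto intro: polynomial_fun.intros polynomial_fun_matrix_component)

text \<open>Newton interpolation, one node at a time: the correction for a new node is a multiple of
  a polynomial vanishing at all earlier ones.\<close>

lemma polynomial_fun_interpolation:
  fixes c :: "complex^'n \<Rightarrow> complex"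
  assumes "finite S"
  shows "\<exists>p. polynomial_fun p \<and> (\<forall>x\<in>S. p x = c x)"
  using assms
proof induction
  case empty
  show ?case using polynomial_fun.const by auto
next
  case (insert a S)
  then obtain p where p: "polynomial_fun p" "\<forall>x\<in>S. p x = c x" by blast
  have "\<forall>b\<in>S. \<exists>i. a $ i \<noteq> b $ i"
    using insert.hyps by (metis vec_eq_iff)
  \<comment> \<open>\<open>i b\<close> is a coordinate telling \<open>a\<close> from
    \<open>b\<close>; it supplies the linear factor of \<open>r\<close> that vanishes at
    \<open>b\<close> but not at \<open>a\<close>.\<close>
  then obtain i where i: "\<And>b. b \<in> S \<Longrightarrow> a $ i b \<noteq> b $ i b" by metis
  define r where "r = (\<lambda>v. \<Prod>b\<in>S. v $ i b - b $ i b)"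
  have r: "polynomial_fun r"
    unfolding r_def by (intro polynomial_fun_prod polynomial_fun_diff polynomial_fun.intros)
  have ra: "r a \<noteq> 0" using i insert.hyps by (auto simp: r_def)
  have rS: "r x = 0" if "x \<in> S" for x
    using that insert.hyps by (auto simp: r_def)
  define q where "q = (\<lambda>v. p v + ((c a - p a) / r a) * r v)"
  have "polynomial_fun q"
    unfolding q_def by (intro polynomial_fun.intros p r)
  moreover have "\<forall>x\<in>insert a S. q x = c x"
    using ra rS p by (auto simp: q_def)
  ultimately show ?case by blast
qed

lemma homogeneous_fun_scale:
  assumes "homogeneous_fun k p"
  shows "p (c *s v) = c ^ k * p v"
proof -
  obtain M :: "('a \<Rightarrow> nat) set" and a where
    M: "\<forall>m\<in>M. (\<Sum>i\<in>UNIV. m i) = k" "p = (\<lambda>v. \<Sum>m\<in>M. a m * (\<Prod>i\<in>UNIV. (v $ i) ^ m i))"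
    using assms unfolding homogeneous_fun_def by blast
  have "(\<Prod>i\<in>UNIV. ((c *s v) $ i) ^ m i) = c ^ k * (\<Prod>i\<in>UNIV. (v $ i) ^ m i)" if "m \<in> M" for m
    using M(1) that by (auto simp: power_mult_distrib prod.distrib simp flip: power_sum)
  thus ?thesis
    unfolding M(2) sum_distrib_left by (intro sum.cong) (auto simp: mult_ac)
qed

section \<open>Invariants separate orbits\<close>

lemma generate_empty_GL: "generate GL {} = {mat 1}"
proof
  show "generate GL {} \<subseteq> {mat 1}"
  proof
    fix x assume "x \<in> generate GL {}"
    thus "x \<in> {mat 1}" by induction (auto simp: GL_def)
  qed
  show "{mat 1} \<subseteq> generate GL {}"
    using generate.one[of GL "{}"] by (simp add: GL_def)
qed

lemma
  assumes "subgroup G GL"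
  shows subgroup_GL_mult: "g \<in> G \<Longrightarrow> h \<in> G \<Longrightarrow> g ** h \<in> G"
    and subgroup_GL_one: "mat 1 \<in> G"
    and subgroup_GL_invertible: "g \<in> G \<Longrightarrow> invertible g"
  using subgroup.m_closed[OF assms] subgroup.one_closed[OF assms] subgroup.subset[OF assms]
  by (auto simp: GL_def)

text \<open>Injective because \<open>g\<close> has a right inverse, hence surjective because
  \<open>G\<close> is finite. Serves to reindex sums over \<open>G\<close> and to find inverses
  inside \<open>G\<close>.\<close>

lemma bij_betw_right_mult:
  fixes G :: "(complex^'n^'n) set"
  assumes "subgroup G GL" "finite G" "g \<in> G"
  shows "bij_betw (\<lambda>h. h ** g) G G"
proof -
  obtain g' where g': "g ** g' = mat 1"
    using subgroup_GL_invertible[OF assms(1,3)] unfolding invertible_def by blast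
  have "inj_on (\<lambda>h. h ** g) G"
    by (rule inj_on_inverseI[where g = "\<lambda>h. h ** g'"]) (simp add: g' flip: matrix_mul_assoc)
  moreover have "(\<lambda>h. h ** g) ` G \<subseteq> G"
    using subgroup_GL_mult[OF assms(1) _ assms(3)] by blast
  ultimately show ?thesis
    using assms(2) by (simp add: bij_betw_def endo_inj_surj)
qed

text \<open>The Reynolds operator without its normalising factor: replacing \<open>v\<close> by
  \<open>g *v v\<close> only permutes the summands.\<close>

lemma invariant_fun_average:
  assumes "subgroup G GL" "finite G" "polynomial_fun p"
  shows "invariant_fun G (\<lambda>v. \<Sum>h\<in>G. p (h *v v))"
  unfolding invariant_fun_def
proof (intro conjI ballI allI)
  show "polynomial_fun (\<lambda>v. \<Sum>h\<in>G. p (h *v v))"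
    by (intro polynomial_fun_sum polynomial_fun_comp_matrix assms)
  fix g v assume "g \<in> G"
  show "(\<Sum>h\<in>G. p (h *v (g *v v))) = (\<Sum>h\<in>G. p (h *v v))"
    using sum.reindex_bij_betw[OF bij_betw_right_mult[OF assms(1,2) \<open>g \<in> G\<close>],
        of "\<lambda>h. p (h *v v)"]
    by (simp add: matrix_vector_mul_assoc)
qed

text \<open>Distinct orbits are disjoint finite sets, so some polynomial is 0 on that of
  \<open>v\<close> and 1 on that of \<open>w\<close>. Its sum over \<open>G\<close> is an invariant
  with values 0 at \<open>v\<close> and \<open>card G\<close> at \<open>w\<close>.\<close>

lemma same_invariants_same_orbit:
  assumes "subgroup G GL" "finite G"
    and inv: "\<And>q. invariant_fun G q \<Longrightarrow> q v = q w"
  shows "\<exists>g\<in>G. g *v v = w"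
proof (rule ccontr)
  assume "\<not> (\<exists>g\<in>G. g *v v = w)"
  hence nw: "g *v v \<noteq> w" if "g \<in> G" for g using that by blast
  define S where "S = (\<lambda>g. g *v v) ` G"
  have disj: "h *v w \<notin> S" if h: "h \<in> G" for h
  proof
    assume "h *v w \<in> S"
    then obtain g where g: "g \<in> G" "h *v w = g *v v" by (auto simp: S_def)
    \<comment> \<open>\<open>k\<close> is the inverse of \<open>h\<close>; it moves a common point
      of both orbits back to \<open>w\<close>.\<close>
    obtain k where k: "k \<in> G" "k ** h = mat 1"
      using bij_betw_right_mult[OF assms(1,2) h] subgroup_GL_one[OF assms(1)]
      unfolding bij_betw_def by (metis imageE)
    have "(k ** g) *v v = (k ** h) *v w"
      using g(2) by (simp flip: matrix_vector_mul_assoc)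
    hence "(k ** g) *v v = w" using k(2) by simp
    thus False using nw subgroup_GL_mult[OF assms(1) k(1) g(1)] by blast
  qed
  obtain p where p: "polynomial_fun p"
      "\<forall>x\<in>S \<union> (\<lambda>h. h *v w) ` G. p x = (if x \<in> S then 0 else 1)"
    using polynomial_fun_interpolation[of "S \<union> (\<lambda>h. h *v w) ` G" "\<lambda>x. if x \<in> S then 0 else 1"]
      assms(2) unfolding S_def by auto
  have "(\<Sum>h\<in>G. p (h *v v)) = 0"
    using p(2) by (intro sum.neutral) (auto simp: S_def)
  moreover have "(\<Sum>h\<in>G. p (h *v w)) = (\<Sum>h\<in>G. 1)"
    using p(2) disj by (intro sum.cong) auto
  ultimately have "of_nat (card G) = (0 :: complex)"
    using inv[OF invariant_fun_average[OF assms(1,2) p(1)]] by simp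
  thus False using assms(2) subgroup_GL_one[OF assms(1)] by auto
qed

text \<open>Every invariant is a polynomial in the basic ones, so agreement on these is
  enough.\<close>

lemma basic_invariants_separate:
  assumes "subgroup G GL" "finite G" "basic_invariants G deg f"
    and eq: "\<And>i. f i v = f i w"
  shows "\<exists>g\<in>G. g *v v = w"
proof (rule same_invariants_same_orbit[OF assms(1,2)])
  fix q assume "invariant_fun G q"
  then obtain p where "q = (\<lambda>v. p (\<chi> i. f i v))"
    using assms(3) unfolding basic_invariants_def by metis
  thus "q v = q w" using eq by simp
qed

section \<open>Unions of eigenspaces\<close>

lemma root_unity_power_eq_1_iff:
  assumes "d \<ge> 1"
  shows "root_unity d ^ k = 1 \<longleftrightarrow> d dvd k"
proof -
  have "root_unity d ^ k = exp (2 * of_real pi * \<i> * of_nat k / of_nat d)"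
    unfolding root_unity_def exp_of_nat_mult[symmetric] by (simp add: mult_ac)
  thus ?thesis using complex_root_unity_eq_1[OF assms, of k] by simp
qed

text \<open>Membership means that \<open>v\<close> and \<open>root_unity d *s v\<close> share an
  orbit, that is, agree on all \<open>f i\<close>. Scaling multiplies \<open>f i v\<close> by
  \<open>root_unity d ^ deg i\<close>, which is 1 exactly when \<open>d\<close> divides
  \<open>deg i\<close>.\<close>

lemma eigen_union_iff:
  assumes "subgroup G GL" "finite G" "basic_invariants G deg f" "d \<ge> 1"
  shows "v \<in> eigen_union G d \<longleftrightarrow> (\<forall>i. f i v \<noteq> 0 \<longrightarrow> d dvd deg i)"
proof -
  have inv: "f i (g *v v) = f i v" if "g \<in> G" for g v i
    using assms(3) that unfolding basic_invariants_def invariant_fun_def by blast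
  have scale: "f i (root_unity d *s v) = root_unity d ^ deg i * f i v" for v i
    using assms(3) homogeneous_fun_scale unfolding basic_invariants_def by blast
  show ?thesis
  proof
    assume "v \<in> eigen_union G d"
    then obtain g where "g \<in> G" "g *v v = root_unity d *s v"
      by (auto simp: eigen_union_def eigenspace_def)
    hence "root_unity d ^ deg i * f i v = f i v" for i using inv scale by metis
    thus "\<forall>i. f i v \<noteq> 0 \<longrightarrow> d dvd deg i"
      using root_unity_power_eq_1_iff[OF assms(4)] by (metis mult_cancel_right1)
  next
    assume "\<forall>i. f i v \<noteq> 0 \<longrightarrow> d dvd deg i"
    hence "f i v = f i (root_unity d *s v)" for i
      using root_unity_power_eq_1_iff[OF assms(4)] unfolding scale
      by (cases "f i v = 0") auto
    thus "v \<in> eigen_union G d"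
      using basic_invariants_separate[OF assms(1-3)] by (auto simp: eigen_union_def eigenspace_def)
  qed
qed

section \<open>The greatest element of \<open>PP G deg\<close> attached to a vector\<close>

lemma PP_maximal_regular_vector:
  assumes "subgroup G GL" "finite G" "invariant_degrees G deg"
    and "regular_vector G v" "v \<noteq> 0"
  shows "\<exists>D\<in>PP G deg. v \<in> eigen_union G D \<and> (\<forall>e\<ge>1. v \<in> eigen_union G e \<longrightarrow> e dvd D)"
proof -
  obtain f where f: "basic_invariants G deg f"
    using assms(3) unfolding invariant_degrees_def by blast
  note deg_pos = invariant_degrees_pos[OF assms(3)]
  \<comment> \<open>Otherwise \<open>v\<close> would share all basic invariants with the origin and
    lie in its orbit \<open>{0}\<close>. This keeps \<open>D\<close> from being the gcd of the empty
    set, which is 0.\<close>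
  have "\<exists>i. f i v \<noteq> 0"
  proof (rule ccontr)
    assume "\<not> (\<exists>i. f i v \<noteq> 0)"
    moreover have "f i 0 = 0" for i
    proof -
      have "f i (0 *s 0) = 0 ^ deg i * f i 0"
        using f homogeneous_fun_scale unfolding basic_invariants_def by blast
      thus ?thesis using deg_pos[of i] by (simp add: power_0_left)
    qed
    ultimately obtain g where "g \<in> G" "g *v 0 = v"
      using basic_invariants_separate[OF assms(1,2) f, of 0 v] by auto
    thus False using assms(5) by simp
  qed
  then obtain i where i: "f i v \<noteq> 0" by blast
  define D where "D = Gcd {deg i | i. f i v \<noteq> 0}"
  have D_dvd: "D dvd deg j" if "f j v \<noteq> 0" for j
    unfolding D_def using that by (intro Gcd_dvd) blast
  have "D \<noteq> 0" using D_dvd[OF i] deg_pos[of i] by auto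
  hence D1: "D \<ge> 1" by simp
  have vD: "v \<in> eigen_union G D"
    using eigen_union_iff[OF assms(1,2) f D1] D_dvd by blast
  have max: "e dvd D" if "e \<ge> 1" "v \<in> eigen_union G e" for e
    unfolding D_def using eigen_union_iff[OF assms(1,2) f that(1)] that(2)
    by (intro Gcd_greatest) blast
  \<comment> \<open>\<open>D\<close> divides every degree entering \<open>dbar deg D\<close>, and
    every degree entering \<open>D\<close> also enters \<open>dbar deg D\<close>.\<close>
  have "D dvd dbar deg D" unfolding dbar_def by (intro Gcd_greatest) blast
  moreover have "dbar deg D dvd deg j" if "f j v \<noteq> 0" for j
    unfolding dbar_def using D_dvd[OF that] by (intro Gcd_dvd) blast
  hence "dbar deg D dvd Gcd {deg i | i. f i v \<noteq> 0}" by (intro Gcd_greatest) blast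
  hence "dbar deg D dvd D" by (simp flip: D_def)
  ultimately have "D = dbar deg D" by (simp add: dvd_antisym)
  moreover have "regular_number G D"
    using vD D1 assms(4) unfolding regular_number_def eigen_union_def by blast
  ultimately have "D \<in> PP G deg" unfolding PP_def by blast
  thus ?thesis using vD max by blast
qed

text \<open>The identity fixes \<open>H\<close> pointwise, so every exponent is positive and the
  discriminant vanishes on each hyperplane.\<close>

lemma milnor_fibre_regular:
  assumes "subgroup G GL" "finite G" "defining_forms G lf" "v \<in> milnor_fibre G lf"
  shows "regular_vector G v"
  unfolding regular_vector_def
proof (intro ballI notI)
  fix H assume H: "H \<in> reflecting_hyperplanes G" "v \<in> H"
  have "mat 1 \<in> {g \<in> G. \<forall>v\<in>H. g *v v = v}"
    using subgroup_GL_one[OF assms(1)] by simp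
  hence "stabiliser_order G H \<noteq> 0"
    using assms(2) unfolding stabiliser_order_def by auto
  moreover have "lf H v = 0" using assms(3) H unfolding defining_forms_def by blast
  \<comment> \<open>Finiteness matters: a product over an infinite set is 1 by convention.\<close>
  moreover have "finite (reflecting_hyperplanes G)"
    using assms(2) by (simp add: reflecting_hyperplanes_def reflections_def)
  ultimately have "discriminant G lf v = 0"
    using H(1) unfolding discriminant_def by (intro prod_zero) auto
  thus False using assms(4) by (simp add: milnor_fibre_def)
qed

text \<open>A coordinate axis is invariant under the trivial group, so it must be the whole
  space.\<close>

lemma irreducible_on_trivial_group:
  fixes i j :: "'n::finite"
  assumes "irreducible_on {mat 1 :: complex^'n^'n}"
  shows "j = i"
proof (rule ccontr)
  assume "j \<noteq> i"
  define W where "W = {v :: complex^'n. \<forall>k. k \<noteq> i \<longrightarrow> v $ k = 0}"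
  have "vec.subspace W" by (auto simp: W_def vec.subspace_def)
  hence "W = {0} \<or> W = UNIV" using assms unfolding irreducible_on_def by auto
  moreover have "axis i 1 \<in> W" "axis i 1 \<noteq> (0 :: complex^'n)" by (auto simp: W_def axis_def vec_eq_iff)
  moreover have "axis j 1 \<notin> W" using \<open>j \<noteq> i\<close> by (auto simp: W_def axis_def)
  ultimately show False by auto
qed

text \<open>
  The origin lies in \<open>F\<close> exactly when \<open>G\<close> is trivial, in which case \<open>\<ell> = 1\<close> and \<open>F = V\<close>. This
  degenerate case has to be treated apart, since the origin lies in every \<open>V(e)\<close>.
\<close>

lemma PP_maximal_milnor_fibre:
  fixes G :: "(complex^'n^'n) set"
  assumes irr: "irreducible_reflection_group G"
    and deg: "invariant_degrees G deg"
    and lf: "defining_forms G lf"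
    and v: "v \<in> milnor_fibre G lf"
  shows "\<exists>D\<in>PP G deg. v \<in> eigen_union G D \<and> (\<forall>e\<in>PP G deg. v \<in> eigen_union G e \<longrightarrow> e dvd D)"
proof -
  have G: "subgroup G GL" "finite G" "generate GL (reflections G) = G" "irreducible_on G"
    using irr unfolding irreducible_reflection_group_def by auto
  note reg = milnor_fibre_regular[OF G(1,2) lf v]
  have PP_pos: "e \<ge> 1" if "e \<in> PP G deg" for e
    using that by (simp add: PP_def regular_number_def)
  show ?thesis
  proof (cases "v = 0")
    case False
    show ?thesis using PP_maximal_regular_vector[OF G(1,2) deg reg False] PP_pos by blast
  next
    case True
    \<comment> \<open>The origin lies on every hyperplane, so its regularity leaves no reflections,
      and the group they generate is trivial.\<close>
    have "0 \<in> fixed_space g" for g :: "complex^'n^'n" by (simp add: fixed_space_def)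
    hence no_refl: "reflections G = {}"
      using reg True unfolding regular_vector_def reflecting_hyperplanes_def by blast
    hence "G = {mat 1}" using G(3) generate_empty_GL by metis
    hence one_dim: "j = i" for i j :: 'n
      using irreducible_on_trivial_group G(4) by metis
    obtain i :: 'n where True by blast
    \<comment> \<open>Every vector is now regular; a nonzero one shows that \<open>PP G deg\<close>
      is nonempty.\<close>
    have "regular_vector G (axis i 1)" "axis i 1 \<noteq> (0 :: complex^'n)"
      using no_refl by (auto simp: regular_vector_def reflecting_hyperplanes_def axis_eq_0_iff)
    then obtain D where D: "D \<in> PP G deg"
      using PP_maximal_regular_vector[OF G(1,2) deg] by blast
    \<comment> \<open>There is a single degree, so \<open>PP G deg\<close> has at most one element
      and maximality is reflexivity of divisibility.\<close>
    have PP_deg: "e = deg i" if "e \<in> PP G deg" for e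
    proof -
      have e: "e \<noteq> 0" "e = Gcd {deg j | j. e dvd deg j}"
        using PP_pos[OF that] that by (auto simp: PP_def dbar_def)
      have "{deg j | j. e dvd deg j} \<noteq> {}" using e by (metis Gcd_empty)
      hence "{deg j | j. e dvd deg j} = {deg i}" using one_dim by (auto, metis+)
      thus ?thesis using e(2) by simp
    qed
    have "v \<in> eigen_union G D"
      using True subgroup_GL_one[OF G(1)] by (auto simp: eigen_union_def eigenspace_def)
    thus ?thesis using D PP_deg by (metis dvd_refl)
  qed
qed

section \<open>Constructible sets\<close>

text \<open>The eigenvector equation gives one linear polynomial per coordinate.\<close>

lemma zariski_closed_eigenspace: "zariski_closed (eigenspace g z)"
proof -
  define S where "S = range (\<lambda>i v. (g *v v) $ i - z * v $ i)"
  have "\<forall>p\<in>S. polynomial_fun p"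
    unfolding S_def
    by (auto intro!: polynomial_fun_diff polynomial_fun_matrix_component polynomial_fun.intros)
  moreover have "eigenspace g z = {v. \<forall>p\<in>S. p v = 0}"
    by (auto simp: S_def eigenspace_def vec_eq_iff)
  ultimately show ?thesis unfolding zariski_closed_def by blast
qed

lemma constructible_subset: "Y \<in> constructible F \<Longrightarrow> Y \<subseteq> F"
  by (induction rule: constructible.induct) auto

lemma constructible_self: "F \<in> constructible F"
proof -
  have "zariski_closed UNIV" unfolding zariski_closed_def by (rule exI[of _ "{}"]) auto
  from constructible.closed[OF this, of F] show ?thesis by simp
qed

lemma constructible_empty: "{} \<in> constructible F"
  using constructible.compl[OF constructible_self] by simp

lemma constructible_diff:
  assumes "Y \<in> constructible F" "Z \<in> constructible F"
  shows "Y - Z \<in> constructible F"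
proof -
  have "Y - Z = F - ((F - Y) \<union> Z)" using constructible_subset[OF assms(1)] by auto
  thus ?thesis using assms by (auto intro!: constructible.intros(2,3))
qed

lemma constructible_UN:
  assumes "finite I" "\<And>i. i \<in> I \<Longrightarrow> Y i \<in> constructible F"
  shows "(\<Union>i\<in>I. Y i) \<in> constructible F"
  using assms by (induction I) (auto intro: constructible.union constructible_empty)

lemma constructible_fibre_part:
  assumes "finite G"
  shows "fibre_part G lf d \<in> constructible (milnor_fibre G lf)"
proof -
  have "fibre_part G lf d = (\<Union>g\<in>G. milnor_fibre G lf \<inter> eigenspace g (root_unity d))"
    by (auto simp: fibre_part_def eigen_union_def)
  thus ?thesis
    using constructible_UN[OF assms] constructible.closed[OF zariski_closed_eigenspace] by metis
qed

lemma constructible_fibre_stratum: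
  assumes "finite G" "invariant_degrees G deg"
  shows "fibre_stratum G deg lf d \<in> constructible (milnor_fibre G lf)"
  unfolding fibre_stratum_def
  using finite_PP[OF assms(2)]
  by (intro constructible_diff constructible_UN constructible_fibre_part[OF assms(1)]) auto

section \<open>Additivity over a finite partition\<close>

lemma additive_on_constructible_UN:
  assumes "additive_on (constructible F) \<beta>" "finite I"
    and "\<And>i. i \<in> I \<Longrightarrow> Y i \<in> constructible F" "disjoint_family_on Y I"
  shows "\<beta> (\<Union>i\<in>I. Y i) = (\<Sum>i\<in>I. \<beta> (Y i))"
  using assms(2-)
proof (induction I)
  case empty
  \<comment> \<open>Cancellation in the group turns this into \<open>\<beta> {} = 0\<close>.\<close>
  have "\<beta> {} = \<beta> {} + \<beta> ({} - {})"
    using assms(1) constructible_empty unfolding additive_on_def by blast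
  thus ?case by simp
next
  case (insert i I)
  let ?U = "\<Union>j\<in>insert i I. Y j"
  have "?U \<in> constructible F" "Y i \<in> constructible F" "Y i \<subseteq> ?U"
    using constructible_UN[of "insert i I" Y F] insert.hyps insert.prems by auto
  hence "\<beta> ?U = \<beta> (Y i) + \<beta> (?U - Y i)"
    using assms(1) unfolding additive_on_def by blast
  moreover have "Y i \<inter> Y j = {}" if "j \<in> I" for j
    using disjoint_family_onD[OF insert.prems(2), of i j] that insert.hyps by auto
  hence "?U - Y i = (\<Union>j\<in>I. Y j)" by auto
  moreover have "disjoint_family_on Y I"
    using insert.prems(2) by (rule disjoint_family_on_mono[rotated]) auto
  ultimately show ?case using insert by simp
qed

theorem lemma2p6:
  fixes G :: "(complex^'n^'n) set"
    and deg :: "'n \<Rightarrow> nat"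
    and lf :: "(complex^'n) set \<Rightarrow> complex^'n \<Rightarrow> complex"
    and \<beta> :: "(complex^'n) set \<Rightarrow> 'a::ab_group_add"
  assumes "irreducible_reflection_group G"
    and "invariant_degrees G deg"
    and "defining_forms G lf"
    and "additive_on (constructible (milnor_fibre G lf)) \<beta>"
  shows "\<beta> (milnor_fibre G lf) = (\<Sum>d\<in>PP G deg. \<beta> (fibre_stratum G deg lf d))"
proof -
  let ?F = "milnor_fibre G lf" and ?P = "PP G deg" and ?S = "fibre_stratum G deg lf"
  have "finite G" using assms(1) unfolding irreducible_reflection_group_def by blast
  obtain D where D: "\<And>v. v \<in> ?F \<Longrightarrow> D v \<in> ?P" "\<And>v. v \<in> ?F \<Longrightarrow> v \<in> eigen_union G (D v)"
      "\<And>v e. v \<in> ?F \<Longrightarrow> e \<in> ?P \<Longrightarrow> v \<in> eigen_union G e \<Longrightarrow> e dvd D v"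
    using PP_maximal_milnor_fibre[OF assms(1-3)] by metis
  \<comment> \<open>A point \<open>v\<close> in the stratum of \<open>d\<close> has \<open>d\<close>
    dividing \<open>D v\<close>, and \<open>D v\<close> different from \<open>d\<close> would have
    removed \<open>v\<close>. Conversely, an \<open>e\<close> removing \<open>v\<close> from the
    stratum of \<open>D v\<close> would be both a multiple and a divisor of \<open>D v\<close>,
    hence equal to it.\<close>
  have stratum_iff: "v \<in> ?S d \<longleftrightarrow> v \<in> ?F \<and> d = D v" if d: "d \<in> ?P" for v d
  proof
    assume "v \<in> ?S d"
    hence v: "v \<in> ?F" "v \<in> eigen_union G d"
      and not: "\<And>e. e \<in> ?P \<Longrightarrow> d dvd e \<Longrightarrow> e \<noteq> d \<Longrightarrow> v \<notin> eigen_union G e"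
      by (auto simp: fibre_stratum_def fibre_part_def)
    show "v \<in> ?F \<and> d = D v"
      using v D(3)[OF v(1) d v(2)] D(1,2)[OF v(1)] not by metis
  next
    assume "v \<in> ?F \<and> d = D v"
    thus "v \<in> ?S d"
      using D by (auto simp: fibre_stratum_def fibre_part_def intro: dvd_antisym)
  qed
  have "?F = (\<Union>d\<in>?P. ?S d)" using D(1) stratum_iff by blast
  moreover have "disjoint_family_on ?S ?P"
    using stratum_iff by (auto simp: disjoint_family_on_def)
  ultimately show ?thesis
    using additive_on_constructible_UN[OF assms(4) finite_PP[OF assms(2)]]
      constructible_fibre_stratum[OF \<open>finite G\<close> assms(2)] by metis
qed

end
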